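(* Let $n\ge 2$ be an integer. The generalized quaternion group $$\mathcal{Q}_{2^n}=\langle a,b \mid a^{2^{n-1}}=1,\ bab^{-1}=a^{-1},\ b^2=a^{2^{n-2}}\rangle$$ does not have any exact factorizations.
   Context: The group $\mathcal{Q}_{2^n}$ has order $2^n$. An exact factorization of a finite group $G$ is a pair $(H,K)$ of subgroups of $G$ with $G=HK$ and $H\cap K=1$; only factorizations in which both $H$ and $K$ are nontrivial are considered. *)

theory Defs
  imports "HOL-Algebra.Coset"
begin

text \<open>
  Group words over an alphabet of type \<open>'g\<close>: the letter \<open>(x, True)\<close> stands for the generator
  \<open>x\<close> and \<open>(x, False)\<close> for its formal inverse.
\<close>

type_synonym 'g word = "('g \<times> bool) list"

text \<open>
  A presentation is given by a set \<open>R\<close> of equations between words; the generators are all elements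
  of \<open>'g\<close>. Two words are equal in the presented group iff they are related by the least congruence
  on words that contains the free cancellations and the equations in \<open>R\<close>. Since the relation is
  closed under arbitrary contexts, this is the quotient of the free group on \<open>'g\<close> by the normal
  closure of the elements \<open>l r\<^sup>-\<^sup>1\<close> for \<open>(l, r) \<in> R\<close>.
\<close>

inductive word_eq :: "('g word \<times> 'g word) set \<Rightarrow> 'g word \<Rightarrow> 'g word \<Rightarrow> bool"
  for R where
  refl: "word_eq R u u"
| sym: "word_eq R u v \<Longrightarrow> word_eq R v u"
| trans: "word_eq R u v \<Longrightarrow> word_eq R v w \<Longrightarrow> word_eq R u w"
| cancel: "word_eq R (u @ [(x, s), (x, \<not> s)] @ v) (u @ v)"
| equation: "(l, r) \<in> R \<Longrightarrow> word_eq R (u @ l @ v) (u @ r @ v)"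

definition word_rel :: "('g word \<times> 'g word) set \<Rightarrow> ('g word \<times> 'g word) set" where
  "word_rel R = {(u, v). word_eq R u v}"

definition presented_group :: "('g word \<times> 'g word) set \<Rightarrow> 'g word set monoid" where
  "presented_group R =
    \<lparr>carrier = UNIV // word_rel R,
     mult = (\<lambda>U V. \<Union>u\<in>U. \<Union>v\<in>V. word_rel R `` {u @ v}),
     one = word_rel R `` {[]}\<rparr>"

lemma word_eq_append_context: "word_eq R u v \<Longrightarrow> word_eq R (p @ u @ q) (p @ v @ q)"
proof (induction rule: word_eq.induct)
  case (cancel u x s v)
  show ?case using word_eq.cancel[of R "p @ u" x s "v @ q"] by simp
next
  case (equation l r u v)
  then show ?case using word_eq.equation[of l r R "p @ u" "v @ q"] by simp
qed (blast intro: word_eq.intros)+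

lemma word_eq_append:
  assumes "word_eq R u u'" "word_eq R v v'"
  shows "word_eq R (u @ v) (u' @ v')"
  using word_eq_append_context[OF assms(1), of "[]" v] word_eq_append_context[OF assms(2), of u' "[]"]
  by (auto intro: word_eq.trans)

lemma equiv_word_rel: "equiv UNIV (word_rel R)"
  by (auto simp: word_rel_def equiv_def refl_on_def sym_def trans_def intro: word_eq.intros)

lemma word_class_eq_iff: "word_rel R `` {u} = word_rel R `` {v} \<longleftrightarrow> word_eq R u v"
  using eq_equiv_class_iff[OF equiv_word_rel, of u v R] by (simp add: word_rel_def)

lemma carrier_presented_group: "carrier (presented_group R) = range (\<lambda>u. word_rel R `` {u})"
  by (auto simp: presented_group_def quotient_def)

lemma one_presented_group: "\<one>\<^bsub>presented_group R\<^esub> = word_rel R `` {[]}"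
  by (simp add: presented_group_def)

lemma mult_presented_group:
  "word_rel R `` {u} \<otimes>\<^bsub>presented_group R\<^esub> word_rel R `` {v} = word_rel R `` {u @ v}"
  by (auto simp: presented_group_def word_rel_def intro: word_eq_append word_eq.trans word_eq.refl)

lemma word_eq_inverse: "word_eq R (rev (map (\<lambda>(x, s). (x, \<not> s)) u) @ u) []"
proof (induction u)
  case (Cons y u)
  obtain x s where y: "y = (x, s)" by (cases y)
  let ?i = "rev (map (\<lambda>(x, s). (x, \<not> s)) u)"
  have "word_eq R (?i @ [(x, \<not> s), (x, \<not> \<not> s)] @ u) (?i @ u)" by (rule word_eq.cancel)
  then show ?case using Cons.IH y by (auto intro: word_eq.trans)
qed (simp add: word_eq.refl)

lemma group_presented_group: "group (presented_group R)"
proof (rule groupI)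
  fix U assume "U \<in> carrier (presented_group R)"
  then obtain u where "U = word_rel R `` {u}" by (auto simp: carrier_presented_group)
  then have "word_rel R `` {rev (map (\<lambda>(x, s). (x, \<not> s)) u)} \<otimes>\<^bsub>presented_group R\<^esub> U = \<one>\<^bsub>presented_group R\<^esub>"
    by (simp only: mult_presented_group one_presented_group word_class_eq_iff word_eq_inverse)
  then show "\<exists>V\<in>carrier (presented_group R). V \<otimes>\<^bsub>presented_group R\<^esub> U = \<one>\<^bsub>presented_group R\<^esub>"
    by (auto simp: carrier_presented_group)
qed (auto simp: carrier_presented_group mult_presented_group one_presented_group)

datatype quat_gen = gen_a | gen_b

text \<open>
  The exponents use truncated subtraction, so this is the intended presentation only for
  \<open>n \<ge> 2\<close>. For \<open>n = 2\<close> it is the cyclic group of order 4.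
\<close>

definition generalized_quaternion :: "nat \<Rightarrow> quat_gen word set monoid" where
  "generalized_quaternion n = presented_group
    {(replicate (2 ^ (n - 1)) (gen_a, True), []),
     ([(gen_b, True), (gen_a, True), (gen_b, False)], [(gen_a, False)]),
     ([(gen_b, True), (gen_b, True)], replicate (2 ^ (n - 2)) (gen_a, True))}"

definition exact_factorization :: "('a, 'b) monoid_scheme \<Rightarrow> 'a set \<Rightarrow> 'a set \<Rightarrow> bool" where
  "exact_factorization G H K \<longleftrightarrow>
    subgroup H G \<and> subgroup K G \<and> H <#>\<^bsub>G\<^esub> K = carrier G \<and> H \<inter> K = {\<one>\<^bsub>G\<^esub>}"

end

theory Submission
  imports Defs Complex_Main
begin

text \<open>
  Put \<open>z = a\<^bsup>2^(n-2)\<^esup> = b\<^sup>2\<close>. Every element is \<open>a\<^sup>i\<close> or \<open>a\<^sup>i b\<close>. Since \<open>(a\<^sup>i b)\<^sup>2 = z\<close> and since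
  some power of every nontrivial \<open>a\<^sup>i\<close> is \<open>z\<close>, all nontrivial subgroups contain \<open>z\<close>, so no two of
  them intersect trivially once \<open>z \<noteq> 1\<close>. The latter is seen in the representation on
  \<open>\<complex>\<^sup>2\<close> with \<open>a = diag(w, w\<^sup>-\<^sup>1)\<close> for a primitive \<open>2^(n-1)\<close>-th root of unity \<open>w\<close>, where \<open>z\<close> acts
  as \<open>-1\<close>.
\<close>

text \<open>Factors of 2 in \<open>i\<close> are moved one at a time from the exponent into the
  base, replacing \<open>a\<close> by its square and lowering \<open>k\<close>. For odd
  \<open>i\<close> the exponent \<open>2 ^ k\<close> serves as \<open>m\<close>, since
  \<open>2 ^ k * i\<close> is congruent to \<open>2 ^ k\<close> modulo
  \<open>2 ^ Suc k\<close>.\<close>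

lemma (in group) two_power_order_pow:
  assumes "a \<in> carrier G" "a [^] (2 ^ Suc k :: nat) = \<one>" "a [^] (i :: nat) \<noteq> \<one>"
  shows "\<exists>m :: nat. (a [^] i) [^] m = a [^] (2 ^ k :: nat)"
  using assms
proof (induction k arbitrary: a i)
  case 0
  have "odd i"
  proof
    assume "even i"
    then obtain j where "i = 2 * j" by blast
    then show False using 0 nat_pow_pow[of a 2 j] by simp
  qed
  then obtain j where "i = 2 * j + 1" by (rule oddE)
  then have "a [^] i = a"
    using 0 nat_pow_pow[of a 2 j] by simp
  then show ?case using 0 by (intro exI[of _ 1]) simp
next
  case (Suc k)
  show ?case
  proof (cases "even i")
    case True
    then obtain j where i: "i = 2 * j" by blast
    have "\<exists>m :: nat. ((a [^] (2 :: nat)) [^] j) [^] m = (a [^] (2 :: nat)) [^] (2 ^ k :: nat)"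
      using Suc.prems i by (intro Suc.IH) (simp_all add: nat_pow_pow)
    then show ?thesis using Suc.prems i by (simp add: nat_pow_pow)
  next
    case False
    then obtain j where j: "i = 2 * j + 1" by (rule oddE)
    have "(a [^] i) [^] (2 ^ Suc k :: nat) = a [^] ((2 ^ Suc (Suc k)) * j + 2 ^ Suc k :: nat)"
      unfolding nat_pow_pow[OF Suc.prems(1)]
      by (rule arg_cong[where f = "\<lambda>e. a [^] e"]) (simp add: j algebra_simps)
    also have "\<dots> = (a [^] (2 ^ Suc (Suc k) :: nat)) [^] j \<otimes> a [^] (2 ^ Suc k :: nat)"
      using Suc.prems(1) by (simp only: nat_pow_pow nat_pow_mult)
    also have "\<dots> = a [^] (2 ^ Suc k :: nat)"
      using Suc.prems by (simp only: nat_pow_one l_one nat_pow_closed)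
    finally show ?thesis by blast
  qed
qed

text \<open>Here \<open>k\<close> stands for n - 2, which keeps truncated subtraction out of the
  exponents of the relations. That \<open>a\<close> and \<open>b\<close> generate the group enters
  only later, as the inclusion of the carrier in \<open>normal_forms\<close>.\<close>

locale quaternion_relations = group G for G (structure) +
  fixes a b :: 'a and k :: nat
  assumes a: "a \<in> carrier G" and b: "b \<in> carrier G"
    and a_order: "a [^] (2 ^ Suc k :: nat) = \<one>"
    and b_conj: "b \<otimes> a \<otimes> inv b = inv a"
    and b_square: "b \<otimes> b = a [^] (2 ^ k :: nat)"
begin

definition normal_forms :: "'a set" where
  "normal_forms = (range (\<lambda>i :: nat. a [^] i) \<union> range (\<lambda>i :: nat. a [^] i \<otimes> b))"

lemma b_mult_a_pow: "b \<otimes> a [^] (i :: nat) = inv a [^] i \<otimes> b"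
proof (induction i)
  case (Suc i)
  have ba: "b \<otimes> a = inv a \<otimes> b"
    using a b b_conj by (metis inv_solve_right inv_closed m_closed)
  have "b \<otimes> a [^] Suc i = inv a [^] i \<otimes> (b \<otimes> a)"
    using a b Suc.IH by (simp flip: m_assoc)
  then show ?case using a b ba by (simp add: m_assoc)
qed (simp add: b)

text \<open>Normal forms carry natural exponents, so the inverses of the generators have to be
  rewritten as products of nonnegative powers.\<close>

lemma inv_a: "inv a = a [^] (2 ^ Suc k - 1 :: nat)"
proof (rule inv_equality)
  have "a [^] (2 ^ Suc k - 1 :: nat) \<otimes> a = a [^] Suc (2 ^ Suc k - 1)"
    by (simp only: nat_pow_Suc)
  then show "a [^] (2 ^ Suc k - 1 :: nat) \<otimes> a = \<one>"
    using a_order by simp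
qed (use a in auto)

lemma inv_b: "inv b = a [^] (2 ^ k :: nat) \<otimes> b"
proof (rule inv_equality)
  have "a [^] (2 ^ k :: nat) \<otimes> b \<otimes> b = a [^] (2 ^ k + 2 ^ k :: nat)"
    using a b by (simp add: m_assoc b_square nat_pow_mult)
  then show "a [^] (2 ^ k :: nat) \<otimes> b \<otimes> b = \<one>"
    using a_order by (simp add: mult_2)
qed (use a b in auto)

lemma a_pow_mult_normal_forms:
  assumes "x \<in> normal_forms"
  shows "a [^] (j :: nat) \<otimes> x \<in> normal_forms"
  using assms a b by (auto simp: normal_forms_def nat_pow_mult simp flip: m_assoc)

text \<open>Left multiplication by \<open>b\<close> swaps the two families: a^i goes to a^(-i) b,
  and a^i b goes to a^(-i) b^2, again a power of \<open>a\<close>.\<close>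

lemma b_mult_normal_forms:
  assumes "x \<in> normal_forms"
  shows "b \<otimes> x \<in> normal_forms"
proof -
  have 1: "b \<otimes> a [^] i = a [^] ((2 ^ Suc k - 1) * i) \<otimes> b" for i :: nat
    using a by (simp only: b_mult_a_pow inv_a nat_pow_pow)
  have 2: "b \<otimes> (a [^] i \<otimes> b) = a [^] ((2 ^ Suc k - 1) * i + 2 ^ k)" for i :: nat
  proof -
    have "b \<otimes> (a [^] i \<otimes> b) = a [^] ((2 ^ Suc k - 1) * i) \<otimes> (b \<otimes> b)"
      using a b by (simp only: m_assoc[symmetric] 1 nat_pow_closed m_closed)
    then show ?thesis using a by (simp only: b_square nat_pow_mult)
  qed
  show ?thesis using assms unfolding normal_forms_def by (auto simp only: 1 2)
qed

lemma a_mult_normal_forms: "x \<in> normal_forms \<Longrightarrow> a \<otimes> x \<in> normal_forms"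
  using a_pow_mult_normal_forms[of x 1] a by simp

lemma inv_a_mult_normal_forms: "x \<in> normal_forms \<Longrightarrow> inv a \<otimes> x \<in> normal_forms"
  by (simp only: inv_a a_pow_mult_normal_forms)

lemma normal_forms_closed: "normal_forms \<subseteq> carrier G"
  using a b by (auto simp: normal_forms_def)

lemma inv_b_mult_normal_forms: "x \<in> normal_forms \<Longrightarrow> inv b \<otimes> x \<in> normal_forms"
  using a b normal_forms_closed a_pow_mult_normal_forms[OF b_mult_normal_forms, of x]
  by (auto simp: inv_b m_assoc)

lemma one_normal_forms: "\<one> \<in> normal_forms"
  unfolding normal_forms_def using nat_pow_0[of a] by (metis UnI1 rangeI)

lemma normal_form_pow:
  assumes "x \<in> normal_forms" "x \<noteq> \<one>"
  shows "\<exists>m :: nat. x [^] m = a [^] (2 ^ k :: nat)"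
  using assms(1) unfolding normal_forms_def
proof (elim UnE rangeE)
  fix i :: nat assume "x = a [^] i"
  then show ?thesis using two_power_order_pow[OF a a_order] assms(2) by blast
next
  fix i :: nat assume x: "x = a [^] i \<otimes> b"
  \<comment> \<open>Moving the inner \<open>b\<close> to the right inverts the second a^i, which
    then cancels the first and leaves b^2.\<close>
  have "x \<otimes> x = a [^] i \<otimes> (b \<otimes> a [^] i) \<otimes> b"
    using a b x by (simp add: m_assoc)
  also have "\<dots> = a [^] i \<otimes> (inv (a [^] i) \<otimes> (b \<otimes> b))"
    using a b by (simp add: m_assoc b_mult_a_pow nat_pow_inv)
  also have "\<dots> = a [^] (2 ^ k :: nat)"
    using a b by (simp add: b_square flip: m_assoc)
  finally have "x [^] (2 :: nat) = a [^] (2 ^ k :: nat)"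
    using a b x by (simp add: numeral_2_eq_2)
  then show ?thesis by blast
qed

lemma nontrivial_subgroup_contains_involution:
  assumes "carrier G \<subseteq> normal_forms" "subgroup H G" "H \<noteq> {\<one>}"
  shows "a [^] (2 ^ k :: nat) \<in> H"
proof -
  obtain x where x: "x \<in> H" "x \<noteq> \<one>"
    using assms(2,3) subgroup.one_closed by blast
  then obtain m :: nat where "x [^] m = a [^] (2 ^ k :: nat)"
    using normal_form_pow assms(1,2) subgroup.subset by blast
  moreover have "x [^] m \<in> H"
    by (induction m) (use x(1) assms(2) in \<open>auto intro: subgroup.m_closed subgroup.one_closed\<close>)
  ultimately show ?thesis by simp
qed

end

text \<open>Soundness of a model: if letters act as functions so that inverse letters cancel and the
  relations hold, equal words act equally. Two words are thus shown to differ by exhibiting an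
  action that separates them.\<close>

lemma word_eq_foldr:
  assumes "word_eq R u v"
    and "\<And>x s. f (x, s) \<circ> f (x, \<not> s) = id"
    and "\<And>l r. (l, r) \<in> R \<Longrightarrow> foldr f l = foldr f r"
  shows "foldr f u = foldr f v"
  using assms(1)
proof induction
  case (cancel u x s v)
  then show ?case using assms(2)[of x s] by (simp add: fun_eq_iff)
next
  case (equation l r u v)
  then show ?case using assms(3) by (simp add: fun_eq_iff)
qed auto

lemma presented_group_pow_generator:
  "(word_rel R `` {[y]}) [^]\<^bsub>presented_group R\<^esub> (m :: nat) = word_rel R `` {replicate m y}"
proof (induction m)
  case 0
  interpret group "presented_group R" by (rule group_presented_group)
  show ?case by (simp add: one_presented_group)
next
  case (Suc m)
  interpret group "presented_group R" by (rule group_presented_group)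
  show ?case using Suc by (simp add: mult_presented_group replicate_append_same)
qed

lemma presented_group_inv_generator:
  "inv\<^bsub>presented_group R\<^esub> (word_rel R `` {[(x, s)]}) = word_rel R `` {[(x, \<not> s)]}"
proof -
  interpret group "presented_group R" by (rule group_presented_group)
  show ?thesis
  proof (rule inv_equality)
    show "word_rel R `` {[(x, \<not> s)]} \<otimes>\<^bsub>presented_group R\<^esub> word_rel R `` {[(x, s)]} = \<one>\<^bsub>presented_group R\<^esub>"
      using word_eq.cancel[of R "[]" x "\<not> s" "[]"]
      by (simp add: mult_presented_group one_presented_group word_class_eq_iff)
  qed (auto simp: carrier_presented_group)
qed

text \<open>The matrices diag(w, 1/w) and ((0, -1), (1, 0)) with their inverses, written as maps on
  pairs. For \<open>False\<close> to undo \<open>True\<close> on \<open>gen_a\<close>,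
  \<open>w\<close> must be nonzero.\<close>

fun quat_action :: "complex \<Rightarrow> quat_gen \<times> bool \<Rightarrow> complex \<times> complex \<Rightarrow> complex \<times> complex" where
  "quat_action w (gen_a, True) (x, y) = (w * x, inverse w * y)"
| "quat_action w (gen_a, False) (x, y) = (inverse w * x, w * y)"
| "quat_action w (gen_b, True) (x, y) = (- y, x)"
| "quat_action w (gen_b, False) (x, y) = (y, - x)"

lemma quat_action_gen_a_funpow:
  "(quat_action w (gen_a, True) ^^ m) (x, y) = (w ^ m * x, inverse w ^ m * y)"
  by (induction m) auto

context
  fixes n :: nat
  assumes n: "n \<ge> 2"
begin

private definition relations where
  "relations = {(replicate (2 ^ (n - 1)) (gen_a, True), []),
     ([(gen_b, True), (gen_a, True), (gen_b, False)], [(gen_a, False)]),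
     ([(gen_b, True), (gen_b, True)], replicate (2 ^ (n - 2)) (gen_a, True))}"

private abbreviation cls where "cls u \<equiv> word_rel relations `` {u}"

private lemma generalized_quaternion_eq: "generalized_quaternion n = presented_group relations"
  by (simp add: generalized_quaternion_def relations_def)

private lemma quaternion_relations_generalized_quaternion:
  "quaternion_relations (generalized_quaternion n) (cls [(gen_a, True)]) (cls [(gen_b, True)]) (n - 2)"
proof -
  interpret group "presented_group relations" by (rule group_presented_group)
  have rel: "cls l = cls r" if "(l, r) \<in> relations" for l r
    using word_eq.equation[OF that, of "[]" "[]"] by (simp add: word_class_eq_iff)
  \<comment> \<open>This is where n \<ge> 2 matters: it matches the exponent 2^(n - 1) of the
    presentation with \<open>2 ^ Suc k\<close> of the locale.\<close>
  have k: "Suc (n - 2) = n - 1" using n by simp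
  have "cls (replicate (2 ^ Suc (n - 2)) (gen_a, True)) = cls []"
    "cls [(gen_b, True), (gen_a, True), (gen_b, False)] = cls [(gen_a, False)]"
    "cls [(gen_b, True), (gen_b, True)] = cls (replicate (2 ^ (n - 2)) (gen_a, True))"
    unfolding k by (rule rel, simp add: relations_def)+
  then show ?thesis
    unfolding generalized_quaternion_eq
    by unfold_locales
      (auto simp: presented_group_pow_generator presented_group_inv_generator
        mult_presented_group one_presented_group carrier_presented_group simp del: power_Suc)
qed

private lemma involution_nontrivial:
  "(cls [(gen_a, True)]) [^]\<^bsub>generalized_quaternion n\<^esub> (2 ^ (n - 2) :: nat) \<noteq> \<one>\<^bsub>generalized_quaternion n\<^esub>"
proof
  assume "(cls [(gen_a, True)]) [^]\<^bsub>generalized_quaternion n\<^esub> (2 ^ (n - 2) :: nat) = \<one>\<^bsub>generalized_quaternion n\<^esub>"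
  then have eq: "word_eq relations (replicate (2 ^ (n - 2)) (gen_a, True)) []"
    by (simp add: generalized_quaternion_eq presented_group_pow_generator one_presented_group word_class_eq_iff)
  \<comment> \<open>A primitive 2^(n - 1)-th root of unity, chosen so that its 2^(n - 2)-th power is
    cis pi = -1.\<close>
  define w where "w = cis (pi / 2 ^ (n - 2))"
  have w0: "w \<noteq> 0" by (simp add: w_def)
  have wk: "w ^ (2 ^ (n - 2)) = - 1"
    by (simp add: w_def Complex.DeMoivre)
  have "n - 1 = Suc (n - 2)" using n by simp
  then have "(2::nat) ^ (n - 1) = 2 ^ (n - 2) * 2"
    by (simp only: power_Suc2)
  then have wk2: "w ^ (2 ^ (n - 1)) = 1"
    by (simp add: power_mult wk)
  have "foldr (quat_action w) (replicate (2 ^ (n - 2)) (gen_a, True)) = foldr (quat_action w) []"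
  proof (rule word_eq_foldr[OF eq])
    fix x s show "quat_action w (x, s) \<circ> quat_action w (x, \<not> s) = id"
      using w0 by (cases x; cases s) (auto simp: fun_eq_iff)
  next
    fix l r assume "(l, r) \<in> relations"
    \<comment> \<open>The relation on the power of \<open>a\<close> is \<open>wk2\<close>;
      conjugation by b swaps the coordinates and so exchanges w with its inverse; b^2 negates both
      coordinates, as a^(2^(n - 2)) does by \<open>wk\<close>.\<close>
    then show "foldr (quat_action w) l = foldr (quat_action w) r"
      by (auto simp: relations_def fun_eq_iff quat_action_gen_a_funpow power_inverse wk wk2
          simp del: One_nat_def)
  qed
  \<comment> \<open>The word for z sends (1, 1) to (-1, -1), which contradicts its acting as the
    identity.\<close>
  then have "foldr (quat_action w) (replicate (2 ^ (n - 2)) (gen_a, True)) (1, 1) = (1, 1)"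
    by simp
  then show False by (simp add: quat_action_gen_a_funpow wk)
qed

lemma generalized_quaternion_subgroups_share_involution:
  "\<exists>z. z \<noteq> \<one>\<^bsub>generalized_quaternion n\<^esub> \<and>
    (\<forall>H. subgroup H (generalized_quaternion n) \<longrightarrow> H \<noteq> {\<one>\<^bsub>generalized_quaternion n\<^esub>} \<longrightarrow> z \<in> H)"
proof -
  interpret quaternion_relations "generalized_quaternion n" "cls [(gen_a, True)]" "cls [(gen_b, True)]" "n - 2"
    by (rule quaternion_relations_generalized_quaternion)
  \<comment> \<open>Every element is the class of a word, and words are built from the left by the
    four signed letters, each of which preserves \<open>normal_forms\<close>.\<close>
  have "cls u \<in> normal_forms" for u
  proof (induction u)
    case Nil
    show ?case using one_normal_forms by (simp add: generalized_quaternion_eq one_presented_group)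
  next
    case (Cons y u)
    obtain x s where y: "y = (x, s)" by (cases y)
    have eq: "cls ((x, t) # u) = cls [(x, t)] \<otimes>\<^bsub>generalized_quaternion n\<^esub> cls u" for x t
      by (simp add: generalized_quaternion_eq mult_presented_group)
    have inv: "cls [(x, False)] = inv\<^bsub>generalized_quaternion n\<^esub> cls [(x, True)]" for x
      by (simp add: generalized_quaternion_eq presented_group_inv_generator)
    show ?case
      using a_mult_normal_forms[OF Cons.IH] inv_a_mult_normal_forms[OF Cons.IH]
        b_mult_normal_forms[OF Cons.IH] inv_b_mult_normal_forms[OF Cons.IH]
      by (cases x; cases s) (simp_all add: y eq inv)
  qed
  then have "carrier (generalized_quaternion n) \<subseteq> normal_forms"
    by (auto simp: generalized_quaternion_eq carrier_presented_group)
  then show ?thesis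
    using nontrivial_subgroup_contains_involution involution_nontrivial by blast
qed

end

theorem proposition2p2:
  fixes n :: nat
  assumes "n \<ge> 2"
  shows "\<not> (\<exists>H K. exact_factorization (generalized_quaternion n) H K \<and>
                   H \<noteq> {\<one>\<^bsub>generalized_quaternion n\<^esub>} \<and> K \<noteq> {\<one>\<^bsub>generalized_quaternion n\<^esub>})"
  using generalized_quaternion_subgroups_share_involution[OF assms]
  unfolding exact_factorization_def by blast

end
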